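(* Let $m$ and $k$ be nonnegative integers. As formal power series in $x$, $$\sum_{n=0}^{\infty}\bigl|L_k(\mathcal{C}^m_n)\bigr|\frac{x^n}{n!}=\frac{1}{k!}\left(\frac{e^x-1}{1-m(e^x-1)}\right)^{k},\qquad \sum_{n=0}^{\infty}\bigl|L(\mathcal{C}^m_n)\bigr|\frac{x^n}{n!}=\exp\left(\frac{e^x-1}{1-m(e^x-1)}\right).$$
   Context: For $m\ge 0$, the extended Catalan arrangement is $\mathcal{C}_n^m=\{\{x_i-x_j=a\}: 1\le i<j\le n,\ a\in\mathbb{Z},\ -m\le a\le m\}$ in $\mathbb{R}^n$ (for $n=0$ it is the empty arrangement in $\mathbb{R}^0$). A flat of an arrangement $\mathcal{A}$ is a nonempty intersection of hyperplanes of $\mathcal{A}$ (including the ambient space as the empty intersection); $L(\mathcal{A})$ is the set of flats and $L_k(\mathcal{A})$ the set of flats of dimension $k$. *)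

theory Defs
  imports "HOL-Analysis.Analysis" "HOL-Analysis.Finite_Function_Topology"
begin

text \<open>
  The dimension \<open>n\<close> varies inside the generating functions, so \<open>\<real>\<^sup>n\<close> cannot be a type \<open>real ^ 'n\<close>.
  It is taken to be the \<open>n\<close>-dimensional coordinate subspace of the real vector space
  \<open>nat \<Rightarrow>\<^sub>0 real\<close> of finitely supported functions, with coordinates \<open>x 1, \<dots>, x n\<close>.
\<close>

definition Rn :: "nat \<Rightarrow> (nat \<Rightarrow>\<^sub>0 real) set" where
  "Rn n = {x. Poly_Mapping.keys x \<subseteq> {1..n}}"

definition catalan_hyperplane :: "nat \<Rightarrow> nat \<Rightarrow> nat \<Rightarrow> int \<Rightarrow> (nat \<Rightarrow>\<^sub>0 real) set" where
  "catalan_hyperplane n i j a =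
     {x \<in> Rn n. Poly_Mapping.lookup x i - Poly_Mapping.lookup x j = of_int a}"

definition catalan_arrangement :: "nat \<Rightarrow> nat \<Rightarrow> (nat \<Rightarrow>\<^sub>0 real) set set" where
  "catalan_arrangement m n =
     {catalan_hyperplane n i j a | i j a.
        1 \<le> i \<and> i < j \<and> j \<le> n \<and> - int m \<le> a \<and> a \<le> int m}"

text \<open>
  \<open>E\<close> is the ambient space; intersecting with it makes the empty intersection \<open>E\<close> rather than \<open>UNIV\<close>.
\<close>

definition flats :: "'a set \<Rightarrow> 'a set set \<Rightarrow> 'a set set" where
  "flats E \<A> = {F. F \<noteq> {} \<and> (\<exists>\<B>\<subseteq>\<A>. F = E \<inter> \<Inter>\<B>)}"

text \<open>
  The dimension of an affine subspace, i.e. the dimension of its direction space.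
  The library's \<open>aff_dim\<close> is only available for Euclidean spaces.
\<close>

definition flat_dim :: "'a::real_vector set \<Rightarrow> nat" where
  "flat_dim F = dim {x - y | x y. x \<in> F \<and> y \<in> F}"

definition flats_of_dim ::
  "nat \<Rightarrow> 'a::real_vector set \<Rightarrow> 'a set set \<Rightarrow> 'a set set" where
  "flats_of_dim k E \<A> = {F \<in> flats E \<A>. flat_dim F = k}"

text \<open>There are only finitely many flats, so \<open>card\<close> below is the actual number of flats.\<close>

lemma finite_catalan_arrangement: "finite (catalan_arrangement m n)"
proof -
  have "catalan_arrangement m n \<subseteq>
      (\<lambda>(i, j, a). catalan_hyperplane n i j a) ` ({1..n} \<times> {1..n} \<times> {- int m..int m})"
    unfolding catalan_arrangement_def by force
  then show ?thesis
    by (rule finite_subset) auto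
qed

lemma finite_flats:
  assumes "finite \<A>"
  shows "finite (flats E \<A>)"
proof -
  have "flats E \<A> \<subseteq> (\<lambda>\<B>. E \<inter> \<Inter>\<B>) ` Pow \<A>"
    unfolding flats_def by auto
  then show ?thesis
    by (rule finite_subset) (use assms in auto)
qed

end

theory Submission
  imports Defs
begin

text \<open>
  A flat of the extended Catalan arrangement prescribes some coordinate differences. The coordinates
  tied together in this way form the blocks of a partition of \<open>{1..n}\<close>, and on each block the flat
  fixes the coordinates up to a common translation. Normalising the minimum over a block to \<open>0\<close>
  gives a height function with natural number values. A height function occurs if and only if
  the block is connected through pairs with heights at distance at most \<open>m\<close>, that is, if
  consecutive distinct heights differ by at most \<open>m\<close>. Such a height function is called a profile.
  Partitions with a profile on every block correspond bijectively to flats (\<open>flats_bij\<close>), and the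
  number of blocks is the dimension of the flat (\<open>flat_dim_profile_flat\<close>).

  It remains to count partitions with profiles. Removing the coordinates of height \<open>0\<close> from a block
  leaves either nothing, or one of \<open>m\<close> possible gaps followed by a smaller profile; with
  \<open>E = e^x - 1\<close> the exponential generating function \<open>f\<close> of profiles therefore satisfies
  \<open>f = E + m E f\<close>, whence \<open>f = E / (1 - m E)\<close> (\<open>card_profiles\<close>). By the exponential formula
  (\<open>exponential_formula_partitions\<close>), partitions into \<open>k\<close> blocks with a profile on each have generating
  function \<open>f^k / k!\<close>, and summing over \<open>k\<close> gives \<open>exp f\<close>.
\<close>

section \<open>Products of exponential generating functions\<close>

lemma sum_Pow_by_card:
  fixes g :: "nat \<Rightarrow> real"
  assumes "finite S"
  shows "(\<Sum>A\<in>Pow S. g (card A)) = (\<Sum>i=0..card S. real (card S choose i) * g i)"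
proof -
  have "(\<Sum>A\<in>Pow S. g (card A)) = (\<Sum>i=0..card S. \<Sum>A | A \<in> Pow S \<and> card A = i. g (card A))"
    using assms by (intro sum.group[symmetric]) (auto intro: card_mono)
  also have "\<dots> = (\<Sum>i=0..card S. \<Sum>A | A \<subseteq> S \<and> card A = i. g i)"
    by (intro sum.cong) auto
  also have "\<dots> = (\<Sum>i=0..card S. real (card S choose i) * g i)"
    using assms by (simp add: n_subsets)
  finally show ?thesis .
qed

text \<open>
  Splitting a set into an ordered pair of complementary subsets corresponds to multiplying
  exponential generating functions: there are \<open>n choose i\<close> subsets of size \<open>i\<close>, and
  the binomial coefficient supplies the factorials that turn the sum into a Cauchy product.
\<close>

lemma exponential_product_formula:
  fixes F G :: "real fps"
  assumes S: "finite S"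
    and a: "\<And>A. A \<subseteq> S \<Longrightarrow> a A = fact (card A) * fps_nth F (card A)"
    and b: "\<And>A. A \<subseteq> S \<Longrightarrow> b A = fact (card A) * fps_nth G (card A)"
  shows "(\<Sum>A\<in>Pow S. a A * b (S - A)) = fact (card S) * fps_nth (F * G) (card S)"
proof -
  let ?n = "card S"
  define g where "g i = fact i * fps_nth F i * (fact (?n - i) * fps_nth G (?n - i))" for i
  have "(\<Sum>A\<in>Pow S. a A * b (S - A)) = (\<Sum>A\<in>Pow S. g (card A))"
  proof (intro sum.cong refl)
    fix A assume "A \<in> Pow S"
    then have "A \<subseteq> S" by simp
    then have "card (S - A) = ?n - card A"
      using S by (simp add: card_Diff_subset finite_subset)
    then show "a A * b (S - A) = g (card A)"
      using a[OF \<open>A \<subseteq> S\<close>] b[of "S - A"] by (simp add: g_def)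
  qed
  also have "\<dots> = (\<Sum>i=0..?n. real (?n choose i) * g i)"
    by (rule sum_Pow_by_card[OF S])
  also have "\<dots> = (\<Sum>i=0..?n. fact ?n * (fps_nth F i * fps_nth G (?n - i)))"
  proof (intro sum.cong refl)
    fix i assume "i \<in> {0..?n}"
    then have "real (?n choose i) = fact ?n / (fact i * fact (?n - i))"
      by (simp add: binomial_fact)
    then show "real (?n choose i) * g i = fact ?n * (fps_nth F i * fps_nth G (?n - i))"
      by (simp add: g_def field_simps)
  qed
  finally show ?thesis by (simp add: fps_mult_nth sum_distrib_left)
qed

section \<open>The exponential formula for set partitions\<close>

lemma finite_partitions: "finite S \<Longrightarrow> finite {P. partition_on S P \<and> Q P}"
  by (rule finite_subset[of _ "Pow (Pow S)"]) (auto simp: partition_on_def)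

text \<open>
  A partition is determined by the block containing a chosen point \<open>a\<close> and a partition of the
  complement of that block. The block is recorded as \<open>A\<close>, its part other than \<open>a\<close>, so
  that \<open>A\<close> ranges over all subsets of \<open>S - {a}\<close>, the empty one included.
\<close>

lemma partitions_pointed_block:
  assumes "a \<in> S" "finite S"
  shows "bij_betw (\<lambda>(A, Q). insert (insert a A) Q)
           (SIGMA A:Pow (S - {a}). {Q. partition_on (S - insert a A) Q \<and> card Q = k})
           {P. partition_on S P \<and> card P = Suc k}"
    (is "bij_betw ?f ?X ?Y")
proof (rule bij_betw_imageI)
  have notin: "B \<notin> Q" if "partition_on (S - insert a A) Q" "a \<in> B" for A B Q
    using that by (auto simp: partition_on_def)
  show "inj_on ?f ?X"
  proof (rule inj_onI, clarsimp)
    fix A Q A' Q'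
    assume *: "A \<subseteq> S - {a}" "A' \<subseteq> S - {a}"
      "partition_on (S - insert a A) Q" "partition_on (S - insert a A') Q'"
      "insert (insert a A) Q = insert (insert a A') Q'"
    have "insert a A = insert a A'"
      using *(5) notin[OF *(3), of "insert a A'"] by (metis insertCI insertE)
    then have "A = A'" using *(1,2) by auto
    moreover have "Q = Q'"
      using *(5) notin[OF *(3), of "insert a A"] notin[OF *(4), of "insert a A"] \<open>A = A'\<close>
      by (auto simp: insert_eq_iff)
    ultimately show "A = A' \<and> Q = Q'" by blast
  qed
  show "?f ` ?X = ?Y"
  proof (intro equalityI subsetI)
    fix P assume "P \<in> ?f ` ?X"
    then obtain A Q where AQ: "A \<subseteq> S - {a}" "partition_on (S - insert a A) Q" "card Q = k"
      and P: "P = insert (insert a A) Q" by auto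
    have "finite Q" using AQ(2) assms(2) by (meson finite_Diff finite_elements)
    moreover have "partition_on S P"
      unfolding P using AQ(1,2) assms(1)
      by (subst partition_on_insert) (auto simp: disjnt_iff partition_on_def)
    ultimately show "P \<in> ?Y"
      using notin[OF AQ(2), of "insert a A"] AQ(3) P by simp
  next
    fix P assume "P \<in> ?Y"
    then have P: "partition_on S P" "card P = Suc k" by auto
    then obtain B where B: "B \<in> P" "a \<in> B"
      using assms(1) by (auto simp: partition_on_def)
    define A Q where "A = B - {a}" and "Q = P - {B}"
    have BA: "insert a A = B" using B by (auto simp: A_def)
    have PQ: "P = insert B Q" using B by (auto simp: Q_def)
    have "disjnt B (\<Union>Q)"
      using P(1) B(1) by (auto simp: Q_def partition_on_def disjnt_iff disjoint_def)
    then have "partition_on (S - B) Q \<and> B \<subseteq> S"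
      using P(1) partition_on_insert unfolding PQ by metis
    moreover have "card Q = k" using P(2) B(1) by (simp add: Q_def)
    ultimately have "(A, Q) \<in> ?X" using BA by (auto simp: A_def)
    moreover have "P = ?f (A, Q)" by (simp add: BA PQ)
    ultimately show "P \<in> ?f ` ?X" by blast
  qed
qed

text \<open>
  If blocks of size \<open>n\<close> carry total weight \<open>n! [x^n] F\<close>, then partitions into \<open>k\<close> blocks have
  exponential generating function \<open>H k = F^k / k!\<close>. The induction on \<open>k\<close> removes the block through
  a chosen point: this is the identity \<open>H (k + 1)' = F' * H k\<close>, where the derivative accounts for
  the chosen point not being counted among the remaining elements.
\<close>

lemma exponential_formula_partitions:
  fixes F :: "real fps" and w :: "'a set \<Rightarrow> real"
  assumes w: "\<And>B. finite B \<Longrightarrow> B \<noteq> {} \<Longrightarrow> w B = fact (card B) * fps_nth F (card B)"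
    and F0: "fps_nth F 0 = 0"
    and "finite S"
  shows "(\<Sum>P | partition_on S P \<and> card P = k. \<Prod>B\<in>P. w B)
           = fact (card S) * fps_nth (fps_const (1 / fact k) * F ^ k) (card S)"
  using \<open>finite S\<close>
proof (induction k arbitrary: S)
  case 0
  have "{P. partition_on S P \<and> card P = 0} = (if S = {} then {{}} else {})"
    using 0 finite_elements[OF 0] by (auto simp: partition_on_empty) (auto simp: partition_on_def)
  then show ?case using 0 by simp
next
  case (Suc k)
  let ?H = "\<lambda>k. fps_const (1 / fact k) * F ^ k"
  show ?case
  proof (cases "S = {}")
    case True
    then have no_partition: "{P. partition_on S P \<and> card P = Suc k} = {}"
      by (auto simp: partition_on_empty)
    show ?thesis unfolding no_partition using True F0 by simp
  next
    case False
    then obtain a where a: "a \<in> S" by auto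
    let ?T = "S - {a}"
    let ?R = "\<lambda>A. {Q. partition_on (S - insert a A) Q \<and> card Q = k}"
    have R: "?R A = {Q. partition_on (?T - A) Q \<and> card Q = k}" for A
      by (simp add: Diff_insert2[symmetric])
    have T: "finite ?T" "card S = Suc (card ?T)"
      using Suc.prems card.remove[OF Suc.prems a] by simp_all
    have "(\<Sum>P | partition_on S P \<and> card P = Suc k. \<Prod>B\<in>P. w B)
        = (\<Sum>(A, Q)\<in>(SIGMA A:Pow ?T. ?R A). \<Prod>B\<in>insert (insert a A) Q. w B)"
      by (subst sum.reindex_bij_betw[OF partitions_pointed_block[OF a Suc.prems], symmetric])
        (auto intro: sum.cong)
    also have "\<dots> = (\<Sum>A\<in>Pow ?T. \<Sum>Q\<in>?R A. \<Prod>B\<in>insert (insert a A) Q. w B)"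
      using Suc.prems by (intro sum.Sigma[symmetric]) (auto intro!: finite_partitions)
    also have "\<dots> = (\<Sum>A\<in>Pow ?T. w (insert a A) * (\<Sum>Q\<in>?R A. \<Prod>B\<in>Q. w B))"
      unfolding sum_distrib_left
    proof (intro sum.cong refl prod.insert)
      fix A Q assume "Q \<in> ?R A"
      then show "finite Q" "insert a A \<notin> Q"
        using Suc.prems by (auto simp: partition_on_def intro: finite_elements)
    qed
    also have "\<dots> = (\<Sum>A\<in>Pow ?T. w (insert a A) *
        (\<Sum>Q | partition_on (?T - A) Q \<and> card Q = k. \<Prod>B\<in>Q. w B))"
      unfolding R ..
    also have "\<dots> = fact (card ?T) * fps_nth (fps_deriv F * ?H k) (card ?T)"
    proof (rule exponential_product_formula[OF T(1)])
      fix A assume "A \<subseteq> ?T"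
      then have "finite A" "a \<notin> A" using T(1) finite_subset by auto
      then show "w (insert a A) = fact (card A) * fps_nth (fps_deriv F) (card A)"
        by (subst w) (auto simp: algebra_simps)
      show "(\<Sum>Q | partition_on A Q \<and> card Q = k. \<Prod>B\<in>Q. w B) = fact (card A) * fps_nth (?H k) (card A)"
        by (rule Suc.IH[OF \<open>finite A\<close>])
    qed
    also have "fps_deriv F * ?H k = fps_deriv (?H (Suc k))"
    proof -
      have "fps_const (1 / fact (Suc k)) * fps_const (of_nat (Suc k)) = (fps_const (1 / fact k) :: real fps)"
        by (simp add: field_simps del: of_nat_Suc)
      moreover have "fps_deriv (?H (Suc k))
          = (fps_const (1 / fact (Suc k)) * fps_const (of_nat (Suc k))) * (fps_deriv F * F ^ k)"
        by (simp only: fps_deriv_mult_const_left fps_deriv_power diff_Suc_1 mult.assoc)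
      ultimately show ?thesis by (simp only: mult.left_commute)
    qed
    also have "fact (card ?T) * fps_nth (fps_deriv (?H (Suc k))) (card ?T) = fact (card S) * fps_nth (?H (Suc k)) (card S)"
      unfolding T(2) by (simp only: fps_deriv_nth fact_Suc) (simp add: algebra_simps)
    finally show ?thesis .
  qed
qed

section \<open>Gapped integer profiles on a block\<close>

text \<open>
  Heights starting at \<open>0\<close> in which consecutive distinct values differ by at most \<open>m\<close>. Asking
  each positive height for some lower height within distance \<open>m\<close> expresses this without sorting the
  heights, and is directly the step of an induction on the height.
\<close>

definition gapped :: "nat \<Rightarrow> nat set \<Rightarrow> bool" where
  "gapped m V \<longleftrightarrow> 0 \<in> V \<and> (\<forall>v\<in>V. 0 < v \<longrightarrow> (\<exists>u\<in>V. u < v \<and> v \<le> u + m))"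

definition profiles :: "nat \<Rightarrow> 'a set \<Rightarrow> ('a \<Rightarrow> nat) set" where
  "profiles m B = {c \<in> B \<rightarrow>\<^sub>E UNIV. gapped m (c ` B)}"

lemma profiles_empty [simp]: "profiles m {} = {}"
  by (simp add: profiles_def gapped_def)

text \<open>
  Gapped sets other than \<open>{0}\<close> arise uniquely from smaller ones: the smallest positive height \<open>d\<close>
  lies between \<open>1\<close> and \<open>m\<close>, and lowering all positive heights by \<open>d\<close> leaves a gapped set. The
  next two lemmas are the two directions.
\<close>

lemma gapped_raise:
  assumes W: "gapped m W" and d: "0 < d" "d \<le> m"
  shows "gapped m (insert 0 ((\<lambda>v. v + d) ` W))"
  unfolding gapped_def
proof (intro conjI ballI impI)
  fix v assume "v \<in> insert 0 ((\<lambda>v. v + d) ` W)" "0 < v"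
  then obtain u where u: "u \<in> W" "v = u + d" by auto
  show "\<exists>t\<in>insert 0 ((\<lambda>v. v + d) ` W). t < v \<and> v \<le> t + m"
  proof (cases "u = 0")
    case True
    then show ?thesis using u d by auto
  next
    case False
    then obtain t where "t \<in> W" "t < u" "u \<le> t + m"
      using W u(1) by (auto simp: gapped_def)
    then show ?thesis using u by (intro bexI[of _ "t + d"]) auto
  qed
qed simp

lemma gapped_lower:
  assumes V: "gapped m V" and d: "d \<in> V - {0}" and least: "\<And>v. v \<in> V - {0} \<Longrightarrow> d \<le> v"
  shows "d \<le> m" and "gapped m ((\<lambda>v. v - d) ` (V - {0}))"
proof -
  have step: "\<exists>u\<in>V. u < v \<and> v \<le> u + m" if "v \<in> V - {0}" for v
    using V that by (auto simp: gapped_def)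
  from step[OF d] obtain u where u: "u \<in> V" "u < d" "d \<le> u + m" by auto
  with least[of u] have "u = 0" by fastforce
  with u show "d \<le> m" by simp
  show "gapped m ((\<lambda>v. v - d) ` (V - {0}))"
    unfolding gapped_def
  proof (intro conjI ballI impI)
    show "0 \<in> (\<lambda>v. v - d) ` (V - {0})" using d by force
    fix w assume "w \<in> (\<lambda>v. v - d) ` (V - {0})" "0 < w"
    then obtain v where v: "v \<in> V - {0}" "w = v - d" by blast
    with \<open>0 < w\<close> have "d < v" by simp
    from step[OF v(1)] obtain u where u: "u \<in> V" "u < v" "v \<le> u + m" by auto
    show "\<exists>t\<in>(\<lambda>v. v - d) ` (V - {0}). t < w \<and> w \<le> t + m"
    proof (cases "u = 0")
      case True
      then show ?thesis using u v d \<open>d < v\<close> by (intro bexI[of _ "d - d"] imageI) auto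
    next
      case False
      then have "d \<le> u" using least u by simp
      then show ?thesis using False u v \<open>d < v\<close> by (intro bexI[of _ "u - d"] imageI) auto
    qed
  qed
qed

definition stack_profile :: "'a set \<Rightarrow> 'a set \<Rightarrow> nat \<Rightarrow> ('a \<Rightarrow> nat) \<Rightarrow> 'a \<Rightarrow> nat" where
  "stack_profile B A d c = (\<lambda>i\<in>B. if i \<in> A then 0 else c i + d)"

lemma stack_profile_image:
  assumes "A \<subseteq> B" "A \<noteq> {}"
  shows "stack_profile B A d c ` B = insert 0 ((\<lambda>v. v + d) ` c ` (B - A))"
  using assms by (auto simp: stack_profile_def image_iff)

text \<open>
  A profile that is not constantly \<open>0\<close> is a nonempty bottom layer \<open>A\<close>, a gap \<open>d\<close> of at most
  \<open>m\<close>, and a profile on the rest of the block. The rest \<open>B - A\<close> is automatically nonempty, because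
  the empty set carries no profile.
\<close>

lemma profiles_bottom_layer:
  "bij_betw (\<lambda>(A, d, c). stack_profile B A d c)
     (SIGMA A:Pow B - {{}}. {1..m} \<times> profiles m (B - A))
     (profiles m B - {\<lambda>i\<in>B. 0})"
    (is "bij_betw ?f ?X ?Y")
proof (rule bij_betw_imageI)
  have zero: "A = {i\<in>B. stack_profile B A d c i = 0}" if "A \<subseteq> B" "0 < d" for A d c
    using that by (auto simp: stack_profile_def)
  \<comment> \<open>\<open>d\<close> can be read off the stack, as the least height outside the bottom layer: \<open>c\<close> vanishes
    somewhere, so that \<open>d\<close> is attained, and no height outside the layer is below \<open>d'\<close>.\<close>
  have d_le: "d' \<le> d"
    if "stack_profile B A d c = stack_profile B A d' c'" "c \<in> profiles m (B - A)" for A d c d' c'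
  proof -
    have "0 \<in> c ` (B - A)" using that(2) by (simp add: profiles_def gapped_def)
    then obtain i where "i \<in> B - A" "c i = 0" by force
    then show ?thesis using fun_cong[OF that(1), of i] by (simp add: stack_profile_def)
  qed
  show "inj_on ?f ?X"
  proof (rule inj_onI)
    fix s s' assume ss: "s \<in> ?X" "s' \<in> ?X" "?f s = ?f s'"
    obtain A d c where s: "s = (A, d, c)" by (cases s)
    obtain A' d' c' where s': "s' = (A', d', c')" by (cases s')
    have eq: "stack_profile B A d c = stack_profile B A' d' c'" using ss s s' by simp
    have "A = A'" using ss zero[of A d c] zero[of A' d' c'] eq unfolding s s' by auto
    then have c: "c \<in> profiles m (B - A)" "c' \<in> profiles m (B - A)"
      and eq': "stack_profile B A d c = stack_profile B A d' c'"
      using ss eq unfolding s s' by auto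
    have "d = d'" using d_le[OF eq' c(1)] d_le[OF eq'[symmetric] c(2)] by simp
    have "c = c'"
    proof (rule PiE_ext[of c "B - A" "\<lambda>_. UNIV" c'])
      show "c i = c' i" if "i \<in> B - A" for i
        using that fun_cong[OF eq', of i] \<open>d = d'\<close> by (simp add: stack_profile_def)
    qed (use c in \<open>auto simp: profiles_def\<close>)
    then show "s = s'" using \<open>A = A'\<close> \<open>d = d'\<close> s s' by simp
  qed
  show "?f ` ?X = ?Y"
  proof (intro equalityI subsetI)
    fix p assume "p \<in> ?f ` ?X"
    then obtain s where s: "s \<in> ?X" "p = ?f s" by blast
    obtain A d c where "s = (A, d, c)" by (cases s)
    with s have p: "p = stack_profile B A d c"
      and *: "A \<subseteq> B" "A \<noteq> {}" "1 \<le> d" "d \<le> m" "c \<in> profiles m (B - A)" by simp_all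
    from *(5) have "B - A \<noteq> {}" by (metis empty_iff profiles_empty)
    then obtain i where "i \<in> B" "i \<notin> A" by auto
    then have "p i \<noteq> 0" using *(3) by (simp add: p stack_profile_def)
    then have "p \<noteq> (\<lambda>i\<in>B. 0)" using \<open>i \<in> B\<close> by auto
    moreover have "p \<in> profiles m B"
      using * gapped_raise[of m "c ` (B - A)" d]
      by (simp add: p profiles_def stack_profile_image) (simp add: stack_profile_def)
    ultimately show "p \<in> ?Y" by simp
  next
    fix p assume p: "p \<in> ?Y"
    define A where "A = {i\<in>B. p i = 0}"
    define d where "d = (LEAST v. v \<in> p ` (B - A))"
    define c where "c = (\<lambda>i\<in>B - A. p i - d)"
    have gap: "gapped m (p ` B)" and ext: "p \<in> B \<rightarrow>\<^sub>E UNIV" using p by (auto simp: profiles_def)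
    have img: "p ` (B - A) = p ` B - {0}" by (auto simp: A_def)
    have "B - A \<noteq> {}"
    proof
      assume "B - A = {}"
      then have "p i = 0" if "i \<in> B" for i using that by (auto simp: A_def)
      then have "p = (\<lambda>i\<in>B. 0)" by (intro PiE_ext[OF ext]) auto
      then show False using p by simp
    qed
    then have d: "d \<in> p ` B - {0}" unfolding d_def img[symmetric] by (metis LeastI_ex ex_in_conv image_is_empty)
    have least: "d \<le> v" if "v \<in> p ` B - {0}" for v
      using that unfolding d_def img[symmetric] by (rule Least_le)
    have "c ` (B - A) = (\<lambda>v. v - d) ` (p ` B - {0})"
      unfolding img[symmetric] by (auto simp: c_def image_iff)
    then have "c \<in> profiles m (B - A)" "d \<le> m"
      using gapped_lower[OF gap d least] by (auto simp: profiles_def c_def)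
    moreover have "0 \<in> p ` B" using gap by (simp add: gapped_def)
    then have "A \<noteq> {}" by (force simp: A_def)
    ultimately have "(A, d, c) \<in> ?X" using d by (auto simp: A_def)
    moreover have "p = ?f (A, d, c)"
      unfolding prod.case
    proof
      fix i
      consider "i \<notin> B" | "i \<in> A" "i \<in> B" | "i \<in> B - A" by blast
      then show "p i = stack_profile B A d c i"
      proof cases
        case 3
        then have "d \<le> p i" using least img by blast
        then show ?thesis using 3 by (simp add: stack_profile_def c_def)
      qed (use ext in \<open>auto simp: stack_profile_def A_def PiE_iff extensional_def\<close>)
    qed
    ultimately show "p \<in> ?f ` ?X" by (rule rev_image_eqI)
  qed
qed

text \<open>
  A profile amounts to a nonempty list of nonempty layers with one of \<open>m\<close> gaps between consecutive
  layers, so with \<open>E = e^x - 1\<close> profiles have the generating function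
  \<open>E + m E^2 + m^2 E^3 + \<dots> = E / (1 - m E)\<close>.
\<close>

definition stack_egf :: "nat \<Rightarrow> real fps" where
  "stack_egf m = (fps_exp 1 - 1) / (1 - of_nat m * (fps_exp 1 - 1))"

text \<open>
  The fixed point equation \<open>f = E + m E f\<close> has the shape of the recurrence obtained by removing the
  bottom layer of a profile.
\<close>

lemma stack_egf_eq: "stack_egf m = (fps_exp 1 - 1) + of_nat m * ((fps_exp 1 - 1) * stack_egf m)"
proof -
  let ?E = "fps_exp 1 - 1 :: real fps"
  let ?D = "1 - of_nat m * ?E"
  have "fps_nth ?D 0 \<noteq> 0" by simp
  then have "stack_egf m * ?D = ?E"
    by (simp add: stack_egf_def fps_divide_unit mult.assoc inverse_mult_eq_1)
  then show ?thesis by (simp add: algebra_simps)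
qed

lemma finite_profiles: "finite B \<Longrightarrow> finite (profiles m B)"
proof (induction rule: finite_psubset_induct)
  case (psubset B)
  have "finite (SIGMA A:Pow B - {{}}. {1..m} \<times> profiles m (B - A))"
    using psubset by (intro finite_SigmaI finite_cartesian_product) auto
  then have "finite (profiles m B - {\<lambda>i\<in>B. 0})"
    using bij_betw_finite[OF profiles_bottom_layer] by blast
  then show ?case by simp
qed

lemma card_profiles_recurrence:
  assumes "finite B"
  shows "real (card (profiles m B)) =
    of_bool (B \<noteq> {}) + real m * (\<Sum>A\<in>Pow B. of_bool (A \<noteq> {}) * real (card (profiles m (B - A))))"
proof -
  have "card (profiles m B - {\<lambda>i\<in>B. 0}) = card (SIGMA A:Pow B - {{}}. {1..m} \<times> profiles m (B - A))"
    using bij_betw_same_card[OF profiles_bottom_layer] by metis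
  also have "\<dots> = (\<Sum>A\<in>Pow B - {{}}. m * card (profiles m (B - A)))"
    using assms by (subst card_SigmaI) (auto simp: finite_profiles card_cartesian_product)
  also have "real \<dots> = real m * (\<Sum>A\<in>Pow B. of_bool (A \<noteq> {}) * real (card (profiles m (B - A))))"
    using assms by (simp add: sum_distrib_left) (intro sum.mono_neutral_cong_left, auto)
  finally have "real (card (profiles m B - {\<lambda>i\<in>B. 0})) = \<dots>" .
  moreover have zero: "(\<lambda>i\<in>B. 0) \<in> profiles m B" if "B \<noteq> {}"
    using that by (auto simp: profiles_def gapped_def image_iff)
  have "card (profiles m B) = of_bool (B \<noteq> {}) + card (profiles m B - {\<lambda>i\<in>B. 0})"
  proof (cases "B = {}")
    case False
    then show ?thesis
      using card.remove[OF finite_profiles[OF assms] zero[OF False]] by simp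
  qed simp
  ultimately show ?thesis by simp
qed

lemma card_profiles:
  assumes "finite B"
  shows "real (card (profiles m B)) = fact (card B) * fps_nth (stack_egf m) (card B)"
  using assms
proof (induction rule: finite_psubset_induct)
  case (psubset B)
  let ?w = "\<lambda>B. real (card (profiles m B))"
  let ?v = "\<lambda>B. fact (card B) * fps_nth (stack_egf m) (card B)"
  let ?E = "fps_exp 1 - 1 :: real fps"
  have E: "of_bool (A \<noteq> {}) = fact (card A) * fps_nth ?E (card A)" if "A \<subseteq> B" for A
    using finite_subset[OF that \<open>finite B\<close>] by (cases "A = {}") auto
  have "(\<Sum>A\<in>Pow B. of_bool (A \<noteq> {}) * ?w (B - A)) = (\<Sum>A\<in>Pow B. of_bool (A \<noteq> {}) * ?v (B - A))"
    by (intro sum.cong refl) (auto intro!: psubset.IH)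
  also have "\<dots> = fact (card B) * fps_nth (?E * stack_egf m) (card B)"
    by (rule exponential_product_formula[OF \<open>finite B\<close>]) (auto simp: E)
  finally have "?w B = fact (card B) * (fps_nth ?E (card B) + real m * fps_nth (?E * stack_egf m) (card B))"
    unfolding card_profiles_recurrence[OF \<open>finite B\<close>, of m] using E[of B] by (simp only: subset_refl distrib_left mult.left_commute)
  also have "fps_nth ?E (card B) + real m * fps_nth (?E * stack_egf m) (card B)
     = fps_nth (?E + fps_const (real m) * (?E * stack_egf m)) (card B)"
    by (simp only: fps_add_nth fps_mult_left_const_nth)
  also have "?E + fps_const (real m) * (?E * stack_egf m) = stack_egf m"
    using stack_egf_eq[of m] by (simp add: fps_of_nat)
  finally show ?case .
qed

section \<open>Vectors and partitions\<close>

definition vector_on :: "nat set \<Rightarrow> (nat \<Rightarrow> real) \<Rightarrow> nat \<Rightarrow>\<^sub>0 real" where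
  "vector_on S f = Abs_poly_mapping (\<lambda>i. if i \<in> S then f i else 0)"

lemma lookup_vector_on:
  assumes "finite S"
  shows "Poly_Mapping.lookup (vector_on S f) i = (if i \<in> S then f i else 0)"
proof -
  have "finite {i. (if i \<in> S then f i else 0) \<noteq> 0}"
    by (rule finite_subset[OF _ assms]) auto
  then show ?thesis by (simp add: vector_on_def Abs_poly_mapping_inverse)
qed

lemma lookup_scaleR:
  "Poly_Mapping.lookup (r *\<^sub>R x) i = r * Poly_Mapping.lookup (x :: 'a \<Rightarrow>\<^sub>0 real) i"
proof -
  have "finite {i. r *\<^sub>R Poly_Mapping.lookup x i \<noteq> 0}"
    by (rule finite_subset[OF _ finite_lookup[of x]]) auto
  then show ?thesis by (simp add: scaleR_poly_mapping_def Abs_poly_mapping_inverse)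
qed

lemma in_Rn: "x \<in> Rn n \<longleftrightarrow> (\<forall>i. i \<notin> {1..n} \<longrightarrow> Poly_Mapping.lookup x i = 0)"
  unfolding Rn_def subset_iff in_keys_iff mem_Collect_eq by blast

lemma partition_on_block_unique:
  assumes "partition_on S P" "B \<in> P" "C \<in> P" "i \<in> B" "i \<in> C"
  shows "B = C"
  using assms partition_onD2[OF assms(1)] by (auto dest: disjointD)

lemma partition_on_block:
  assumes "partition_on S P" "B \<in> P"
  shows "B \<subseteq> S" "B \<noteq> {}"
  using assms by (auto simp: partition_on_def)

lemma partition_on_interval_block:
  assumes "partition_on {1..n::nat} P" "B \<in> P"
  shows "finite B" "B \<subseteq> {1..n}"
  using finite_subset[OF partition_on_block(1)[OF assms]] partition_on_block(1)[OF assms] by simp_all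

section \<open>Flats from partitions with profiles\<close>

definition profile_flat :: "nat \<Rightarrow> nat set set \<Rightarrow> (nat set \<Rightarrow> nat \<Rightarrow> nat) \<Rightarrow> (nat \<Rightarrow>\<^sub>0 real) set" where
  "profile_flat n P h = {x \<in> Rn n. \<forall>B\<in>P. \<forall>i\<in>B. \<forall>j\<in>B.
     Poly_Mapping.lookup x i - Poly_Mapping.lookup x j = real (h B i) - real (h B j)}"

definition profiled_partitions :: "nat \<Rightarrow> 'a set \<Rightarrow> ('a set set \<times> ('a set \<Rightarrow> 'a \<Rightarrow> nat)) set" where
  "profiled_partitions m S = (SIGMA P:{P. partition_on S P}. \<Pi>\<^sub>E B\<in>P. profiles m B)"

text \<open>
  A point of the flat is obtained by using the profiles themselves as coordinates.
\<close>

lemma profile_flat_nonempty: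
  assumes P: "partition_on {1..n} P"
  shows "profile_flat n P h \<noteq> {}"
proof -
  define block where "block i = (THE B. B \<in> P \<and> i \<in> B)" for i
  have block: "block i = B" if "B \<in> P" "i \<in> B" for i B
    unfolding block_def
    by (rule the_equality) (use that partition_on_block_unique[OF P] in \<open>blast+\<close>)
  define x where "x = vector_on {1..n} (\<lambda>i. real (h (block i) i))"
  have "Poly_Mapping.lookup x i = real (h B i)" if "B \<in> P" "i \<in> B" for i B
  proof -
    have "i \<in> {1..n}" using partition_on_block(1)[OF P that(1)] that(2) by blast
    then show ?thesis using that by (simp add: x_def lookup_vector_on block)
  qed
  moreover have "x \<in> Rn n" unfolding in_Rn x_def by (simp add: lookup_vector_on)
  ultimately have "x \<in> profile_flat n P h"
    by (simp add: profile_flat_def)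
  then show ?thesis by blast
qed

text \<open>
  Each block can be translated independently of the others. Hence the blocks are visible in the flat,
  and their indicator vectors are directions of it.
\<close>

lemma profile_flat_add_indicator:
  assumes P: "partition_on {1..n} P" and B: "B \<in> P" and x: "x \<in> profile_flat n P h"
  shows "x + vector_on B (\<lambda>_. 1) \<in> profile_flat n P h"
proof -
  note B' = partition_on_interval_block[OF P B]
  have same: "i \<in> B \<longleftrightarrow> j \<in> B" if "C \<in> P" "i \<in> C" "j \<in> C" for C i j
    using partition_on_block_unique[OF P B that(1)] that(2,3) by blast
  show ?thesis
    unfolding profile_flat_def
  proof (intro CollectI conjI ballI)
    show "x + vector_on B (\<lambda>_. 1) \<in> Rn n"
      using x B'(2) unfolding profile_flat_def in_Rn
      by (auto simp: lookup_add lookup_vector_on[OF B'(1)])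
    fix C i j assume C: "C \<in> P" "i \<in> C" "j \<in> C"
    then have "Poly_Mapping.lookup x i - Poly_Mapping.lookup x j = real (h C i) - real (h C j)"
      using x by (simp add: profile_flat_def)
    then show "Poly_Mapping.lookup (x + vector_on B (\<lambda>_. 1)) i
        - Poly_Mapping.lookup (x + vector_on B (\<lambda>_. 1)) j = real (h C i) - real (h C j)"
      using same[OF C] B'(1) by (simp add: lookup_add lookup_vector_on)
  qed
qed

text \<open>
  The partition is recovered from the flat: a coordinate difference is constant on the flat exactly
  within a block, since translating a block changes the differences between it and the others.
\<close>

lemma same_block_iff_constant_difference:
  assumes P: "partition_on {1..n} P"
  shows "(\<exists>B\<in>P. i \<in> B \<and> j \<in> B) \<longleftrightarrow>
    i \<in> {1..n} \<and> j \<in> {1..n} \<and>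
    (\<forall>x\<in>profile_flat n P h. \<forall>y\<in>profile_flat n P h.
      Poly_Mapping.lookup x i - Poly_Mapping.lookup x j = Poly_Mapping.lookup y i - Poly_Mapping.lookup y j)"
    (is "?L \<longleftrightarrow> ?R")
proof
  assume ?L
  then obtain B where B: "B \<in> P" "i \<in> B" "j \<in> B" by blast
  then have "i \<in> {1..n}" "j \<in> {1..n}" using partition_on_block(1)[OF P B(1)] by blast+
  then show ?R using B by (auto simp: profile_flat_def)
next
  assume R: ?R
  then obtain B where B: "B \<in> P" "i \<in> B" using partition_onD1[OF P] by blast
  then have "finite B" using partition_on_interval_block[OF P] by blast
  obtain x where x: "x \<in> profile_flat n P h" using profile_flat_nonempty[OF P] by blast
  note profile_flat_add_indicator[OF P B(1) x]
  with R x have "Poly_Mapping.lookup (x + vector_on B (\<lambda>_. 1)) i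
        - Poly_Mapping.lookup (x + vector_on B (\<lambda>_. 1)) j = Poly_Mapping.lookup x i - Poly_Mapping.lookup x j"
    by blast
  then have "j \<in> B" using B \<open>finite B\<close> by (simp add: lookup_add lookup_vector_on split: if_splits)
  with B show ?L by blast
qed

lemma profiles_zero:
  assumes "c \<in> profiles m B"
  obtains i where "i \<in> B" "c i = 0"
proof -
  have "0 \<in> c ` B" using assms by (simp add: profiles_def gapped_def)
  then show ?thesis using that by force
qed

text \<open>
  The flat determines the partition and the differences of heights within each block, and then the
  heights themselves, because every profile takes the value \<open>0\<close> and is nowhere negative.
\<close>

lemma profile_flat_inj:
  "inj_on (\<lambda>(P, h). profile_flat n P h) (profiled_partitions m {1..n})"
proof (rule inj_onI)
  fix s s' assume ss: "s \<in> profiled_partitions m {1..n}" "s' \<in> profiled_partitions m {1..n}"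
    and eq0: "(\<lambda>(P, h). profile_flat n P h) s = (\<lambda>(P, h). profile_flat n P h) s'"
  obtain P h where s: "s = (P, h)" by (cases s)
  obtain P' h' where s': "s' = (P', h')" by (cases s')
  have eq: "profile_flat n P h = profile_flat n P' h'" using eq0 s s' by simp
  have P: "partition_on {1..n} P" and h: "h \<in> (\<Pi>\<^sub>E B\<in>P. profiles m B)"
    using ss s by (auto simp: profiled_partitions_def)
  have P': "partition_on {1..n} P'" and h': "h' \<in> (\<Pi>\<^sub>E B\<in>P'. profiles m B)"
    using ss s' by (auto simp: profiled_partitions_def)
  have "{(i, j). \<exists>B\<in>P. i \<in> B \<and> j \<in> B} = {(i, j). \<exists>B\<in>P'. i \<in> B \<and> j \<in> B}"
    unfolding same_block_iff_constant_difference[OF P, of _ _ h]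
      same_block_iff_constant_difference[OF P', of _ _ h'] eq ..
  then have "P = P'"
    using partition_on_eq_quotient[OF P] partition_on_eq_quotient[OF P'] by simp
  obtain x where x: "x \<in> profile_flat n P h" using profile_flat_nonempty[OF P] by blast
  have le: "c i \<le> c' i"
    if c: "c \<in> profiles m B" and i: "i \<in> B"
      and diff: "\<And>i j. i \<in> B \<Longrightarrow> j \<in> B \<Longrightarrow> real (c i) - real (c j) = real (c' i) - real (c' j)" for c c' :: "nat \<Rightarrow> nat" and B i
  proof -
    obtain i0 where i0: "i0 \<in> B" "c i0 = 0" by (rule profiles_zero[OF c])
    then show ?thesis using diff[OF i i0(1)] by linarith
  qed
  have "h = h'"
  proof (rule PiE_ext[OF h h'[folded \<open>P = P'\<close>]])
    fix B assume B: "B \<in> P"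
    have diff: "real (h B i) - real (h B j) = real (h' B i) - real (h' B j)" if "i \<in> B" "j \<in> B" for i j
    proof -
      have "Poly_Mapping.lookup x i - Poly_Mapping.lookup x j = real (h B i) - real (h B j)"
        using x B that by (simp add: profile_flat_def)
      moreover have "Poly_Mapping.lookup x i - Poly_Mapping.lookup x j = real (h' B i) - real (h' B j)"
        using x[unfolded eq] B that \<open>P = P'\<close> by (simp add: profile_flat_def)
      ultimately show ?thesis by simp
    qed
    have hB: "h B \<in> profiles m B" "h' B \<in> profiles m B"
      using B h h' \<open>P = P'\<close> by auto
    show "h B = h' B"
    proof (rule PiE_ext[of _ B "\<lambda>_. UNIV"])
      show "h B i = h' B i" if "i \<in> B" for i
        using le[OF hB(1) that diff] le[OF hB(2) that diff[symmetric]] by simp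
    qed (use hB in \<open>auto simp: profiles_def\<close>)
  qed
  then show "s = s'" using \<open>P = P'\<close> s s' by simp
qed

text \<open>
  The directions of the flat are the vectors that are constant on blocks; the indicator vectors of
  the blocks form a basis of them.
\<close>

lemma flat_dim_profile_flat:
  assumes P: "partition_on {1..n} P"
  shows "flat_dim (profile_flat n P h) = card P"
proof -
  let ?F = "profile_flat n P h"
  let ?e = "\<lambda>B. vector_on B (\<lambda>_. 1)"
  let ?D = "{x - y | x y. x \<in> ?F \<and> y \<in> ?F}"
  have fin: "finite P" using finite_elements[OF _ P] by simp
  have finB: "finite B" if "B \<in> P" for B
    using partition_on_interval_block[OF P that] by blast
  have lookup_comb: "Poly_Mapping.lookup (\<Sum>B\<in>P. c B *\<^sub>R ?e B) i = c C" if "C \<in> P" "i \<in> C" for c C i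
  proof -
    have "Poly_Mapping.lookup (\<Sum>B\<in>P. c B *\<^sub>R ?e B) i = (\<Sum>B\<in>P. if B = C then c C else 0)"
      unfolding lookup_sum
      using that finB partition_on_block_unique[OF P]
      by (intro sum.cong refl) (auto simp: lookup_scaleR lookup_vector_on)
    then show ?thesis using fin that by simp
  qed
  obtain x0 where x0: "x0 \<in> ?F" using profile_flat_nonempty[OF P] by blast
  have inj: "inj_on ?e P"
  proof (rule inj_onI)
    fix B C assume BC: "B \<in> P" "C \<in> P" "?e B = ?e C"
    obtain i where i: "i \<in> B" using partition_on_block(2)[OF P BC(1)] by blast
    have "Poly_Mapping.lookup (?e B) i = 1" using i finB[OF BC(1)] by (simp add: lookup_vector_on)
    then have "i \<in> C"
      unfolding BC(3) using finB[OF BC(2)] by (simp add: lookup_vector_on split: if_splits)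
    then show "B = C" using partition_on_block_unique[OF P BC(1,2) i] by blast
  qed
  have "dim ?D = card (?e ` P)"
  proof (rule dim_unique[of "?e ` P"])
    show "?e ` P \<subseteq> ?D"
    proof (rule image_subsetI)
      fix B assume "B \<in> P"
      then have "x0 + ?e B \<in> ?F" using profile_flat_add_indicator[OF P _ x0] by blast
      moreover have "?e B = (x0 + ?e B) - x0" by simp
      ultimately show "?e B \<in> ?D" using x0 by blast
    qed
    show "?D \<subseteq> span (?e ` P)"
    proof
      fix z assume "z \<in> ?D"
      then obtain x y where xy: "z = x - y" "x \<in> ?F" "y \<in> ?F" by blast
      have const: "Poly_Mapping.lookup z i = Poly_Mapping.lookup z j" if "B \<in> P" "i \<in> B" "j \<in> B" for B i j
      proof -
        have "Poly_Mapping.lookup x i - Poly_Mapping.lookup x j = Poly_Mapping.lookup y i - Poly_Mapping.lookup y j"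
          using xy(2,3) that by (simp add: profile_flat_def)
        then show ?thesis unfolding xy(1) by (simp add: lookup_minus)
      qed
      define c where "c B = Poly_Mapping.lookup z (SOME i. i \<in> B)" for B
      have "z = (\<Sum>B\<in>P. c B *\<^sub>R ?e B)"
      proof (rule poly_mapping_eqI)
        fix i
        show "Poly_Mapping.lookup z i = Poly_Mapping.lookup (\<Sum>B\<in>P. c B *\<^sub>R ?e B) i"
        proof (cases "i \<in> {1..n}")
          case True
          then obtain C where C: "C \<in> P" "i \<in> C" using partition_onD1[OF P] by blast
          then have "c C = Poly_Mapping.lookup z i"
            unfolding c_def by (intro const[OF C(1)]) (auto intro: someI)
          then show ?thesis by (simp add: lookup_comb[OF C])
        next
          case False
          then have "Poly_Mapping.lookup z i = 0"
            using xy by (simp add: profile_flat_def in_Rn lookup_minus)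
          moreover have "i \<notin> B" if "B \<in> P" for B
            using False that partition_onD1[OF P] by blast
          then have "Poly_Mapping.lookup (\<Sum>B\<in>P. c B *\<^sub>R ?e B) i = 0"
            using finB by (simp add: lookup_sum lookup_scaleR lookup_vector_on)
          ultimately show ?thesis by simp
        qed
      qed
      moreover have "(\<Sum>B\<in>P. c B *\<^sub>R ?e B) \<in> span (?e ` P)"
        by (intro span_sum span_scale span_base imageI)
      ultimately show "z \<in> span (?e ` P)" by (rule ssubst)
    qed
    show "independent (?e ` P)"
    proof (rule independent_if_scalars_zero)
      fix f v assume f: "(\<Sum>v\<in>?e ` P. f v *\<^sub>R v) = 0" and "v \<in> ?e ` P"
      then obtain C where C: "C \<in> P" "v = ?e C" by blast
      then obtain i where "i \<in> C" using partition_on_block(2)[OF P] by blast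
      have "(\<Sum>B\<in>P. f (?e B) *\<^sub>R ?e B) = 0"
        using f by (simp add: sum.reindex[OF inj])
      then show "f v = 0"
        using lookup_comb[OF C(1) \<open>i \<in> C\<close>, of "\<lambda>B. f (?e B)"] C(2) by simp
    qed (use fin in simp)
  qed simp
  then show ?thesis by (simp add: flat_dim_def card_image[OF inj])
qed

lemma catalan_hyperplane_swap: "catalan_hyperplane n i j a = catalan_hyperplane n j i (- a)"
proof -
  have "u - v = real_of_int a \<longleftrightarrow> v - u = real_of_int (- a)" for u v
    by auto
  then show ?thesis unfolding catalan_hyperplane_def by blast
qed

lemma catalan_hyperplane_in_arrangement:
  assumes "i \<noteq> j" "i \<in> {1..n}" "j \<in> {1..n}" "\<bar>a\<bar> \<le> int m"
  shows "catalan_hyperplane n i j a \<in> catalan_arrangement m n"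
proof -
  have *: "catalan_hyperplane n i j a \<in> catalan_arrangement m n"
    if "i < j" "i \<in> {1..n}" "j \<in> {1..n}" "\<bar>a\<bar> \<le> int m" for i j a
    unfolding catalan_arrangement_def using that
    by (intro CollectI exI[of _ i] exI[of _ j] exI[of _ a]) auto
  show ?thesis
  proof (cases "i < j")
    case True
    then show ?thesis using * assms by blast
  next
    case False
    then show ?thesis using *[of j i "- a"] assms catalan_hyperplane_swap[of n i j a] by simp
  qed
qed

section \<open>Every flat arises exactly once\<close>

text \<open>
  The flat is cut out by the hyperplanes of the arrangement that contain it. A point on all of them
  has the prescribed difference between any two coordinates of a block whose heights differ by at
  most \<open>m\<close>; as the profile is gapped, such steps lead from every coordinate down to height \<open>0\<close>.
\<close>

lemma profile_flat_is_flat: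
  assumes P: "partition_on {1..n} P" and h: "\<And>B. B \<in> P \<Longrightarrow> h B \<in> profiles m B"
  shows "profile_flat n P h \<in> flats (Rn n) (catalan_arrangement m n)"
proof -
  let ?F = "profile_flat n P h"
  let ?\<B> = "{H \<in> catalan_arrangement m n. ?F \<subseteq> H}"
  have "x \<in> ?F" if x: "x \<in> Rn n \<inter> \<Inter>?\<B>" for x
  proof -
    have close: "Poly_Mapping.lookup x i - Poly_Mapping.lookup x j = real (h B i) - real (h B j)"
      if "B \<in> P" "i \<in> B" "j \<in> B" "\<bar>int (h B i) - int (h B j)\<bar> \<le> int m" for B i j
    proof (cases "i = j")
      case False
      let ?H = "catalan_hyperplane n i j (int (h B i) - int (h B j))"
      have "?H \<in> catalan_arrangement m n"
        using that partition_on_block(1)[OF P that(1)] False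
        by (intro catalan_hyperplane_in_arrangement) auto
      moreover have "?F \<subseteq> ?H"
        using that(1-3) by (auto simp: profile_flat_def catalan_hyperplane_def)
      ultimately have "x \<in> ?H" using x by blast
      then show ?thesis by (simp add: catalan_hyperplane_def)
    qed simp
    have "Poly_Mapping.lookup x i - Poly_Mapping.lookup x j = real (h B i) - real (h B j)"
      if B: "B \<in> P" and ij: "i \<in> B" "j \<in> B" for B i j
    proof -
      obtain i0 where i0: "i0 \<in> B" "h B i0 = 0" by (rule profiles_zero[OF h[OF B]])
      have from_zero: "Poly_Mapping.lookup x i = Poly_Mapping.lookup x i0 + real (h B i)" if "i \<in> B" for i
        using that
      proof (induction "h B i" arbitrary: i rule: less_induct)
        case less
        show ?case
        proof (cases "h B i = 0")
          case True
          then show ?thesis using close[OF B less.prems i0(1)] i0 by simp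
        next
          case False
          have "gapped m (h B ` B)" using h[OF B] by (simp add: profiles_def)
          with False less.prems obtain j where j: "j \<in> B" "h B j < h B i" "h B i \<le> h B j + m"
            unfolding gapped_def by blast
          then show ?thesis
            using less.hyps[OF j(2,1)] close[OF B less.prems j(1)] by simp
        qed
      qed
      show ?thesis using from_zero[OF ij(1)] from_zero[OF ij(2)] by simp
    qed
    then show ?thesis using x by (simp add: profile_flat_def)
  qed
  then have "?F = Rn n \<inter> \<Inter>?\<B>" by (auto simp: profile_flat_def)
  moreover have "?\<B> \<subseteq> catalan_arrangement m n" by (rule Collect_restrict)
  ultimately show ?thesis
    unfolding flats_def using profile_flat_nonempty[OF P]
    by (intro CollectI conjI exI[of _ ?\<B>])
qed

lemma rtrancl_crossing:
  assumes "(a, b) \<in> r\<^sup>*" "Q a" "\<not> Q b"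
  obtains u v where "(a, u) \<in> r\<^sup>*" "(u, v) \<in> r" "Q u" "\<not> Q v"
proof -
  have "\<exists>u v. (a, u) \<in> r\<^sup>* \<and> (u, v) \<in> r \<and> Q u \<and> \<not> Q v"
    using assms
  proof (induction rule: rtrancl_induct)
    case (step y z)
    then show ?case by (cases "Q y") blast+
  qed simp
  then show ?thesis using that by blast
qed

text \<open>
  Conversely, take a point \<open>x0\<close> of a flat. The hyperplanes defining the flat are edges of a graph
  on the coordinates, whose connected components are the blocks. Along an edge the coordinates of
  \<open>x0\<close> differ by an integer of absolute value at most \<open>m\<close>, so \<open>x0\<close> minus its minimum over a
  block takes natural number values there. These are gapped: a path from the minimum to a coordinate
  \<open>i\<close> has an edge that enters the set of coordinates at least as high as \<open>i\<close>, and its start is lower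
  than \<open>i\<close> by at most \<open>m\<close>.
\<close>

lemma flat_is_profile_flat:
  assumes F: "F \<in> flats (Rn n) (catalan_arrangement m n)"
  obtains P h where "(P, h) \<in> profiled_partitions m {1..n}" "F = profile_flat n P h"
proof -
  obtain \<B> where \<B>: "\<B> \<subseteq> catalan_arrangement m n" "F = Rn n \<inter> \<Inter>\<B>" and "F \<noteq> {}"
    using F by (auto simp: flats_def)
  then obtain x0 where x0: "x0 \<in> F" by blast
  define p where "p = Poly_Mapping.lookup x0"
  define E where "E = {(i, j). i \<in> {1..n} \<and> j \<in> {1..n} \<and> (\<exists>a. \<bar>a\<bar> \<le> int m \<and> catalan_hyperplane n i j a \<in> \<B>)}"
  have edge: "Poly_Mapping.lookup x i - Poly_Mapping.lookup x j = p i - p j \<and>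
      (\<exists>a::int. p i - p j = of_int a) \<and> \<bar>p i - p j\<bar> \<le> real m"
    if "x \<in> F" "(i, j) \<in> E" for x i j
  proof -
    obtain a where a: "\<bar>a\<bar> \<le> int m" "catalan_hyperplane n i j a \<in> \<B>" using \<open>(i, j) \<in> E\<close> by (auto simp: E_def)
    then have "x \<in> catalan_hyperplane n i j a" "x0 \<in> catalan_hyperplane n i j a"
      using x0 \<open>x \<in> F\<close> \<B>(2) by auto
    moreover have "\<bar>real_of_int a\<bar> \<le> real m" using a(1) by linarith
    ultimately show ?thesis by (auto simp: catalan_hyperplane_def p_def)
  qed
  have in_F: "x \<in> F" if x: "x \<in> Rn n"
    and xE: "\<And>i j. (i, j) \<in> E \<Longrightarrow> Poly_Mapping.lookup x i - Poly_Mapping.lookup x j = p i - p j" for x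
  proof -
    have "x \<in> H" if "H \<in> \<B>" for H
    proof -
      obtain i j a where H: "H = catalan_hyperplane n i j a" "1 \<le> i" "i < j" "j \<le> n" "\<bar>a\<bar> \<le> int m"
        using \<open>H \<in> \<B>\<close> \<B>(1) by (fastforce simp: catalan_arrangement_def)
      then have "(i, j) \<in> E" using \<open>H \<in> \<B>\<close> by (auto simp: E_def)
      moreover have "p i - p j = of_int a"
        using x0 \<B>(2) \<open>H \<in> \<B>\<close> H(1) by (auto simp: p_def catalan_hyperplane_def)
      ultimately show ?thesis using xE x H(1) by (simp add: catalan_hyperplane_def)
    qed
    then show ?thesis using x \<B>(2) by blast
  qed
  have "sym E"
    by (rule symI) (auto simp: E_def, metis abs_minus_cancel catalan_hyperplane_swap)
  define r where "r = {(i, j). i \<in> {1..n} \<and> j \<in> {1..n} \<and> (i, j) \<in> E\<^sup>*}"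
  have "equiv {1..n} r"
  proof (rule equivI)
    show "sym r"
      using symD[OF sym_rtrancl[OF \<open>sym E\<close>]] unfolding r_def by (intro symI) blast
    show "trans r" unfolding r_def by (intro transI) (blast intro: rtrancl_trans)
  qed (auto simp: r_def intro: refl_onI)
  define P where "P = {1..n} // r"
  have P: "partition_on {1..n} P" unfolding P_def using partition_on_quotient \<open>equiv {1..n} r\<close> by blast
  have connected: "(i, j) \<in> E\<^sup>*" if "B \<in> P" "i \<in> B" "j \<in> B" for B i j
    using quotient_eq_iff[OF \<open>equiv {1..n} r\<close>, of B B i j] that by (auto simp: P_def r_def)
  have closed: "j \<in> B" if "B \<in> P" "i \<in> B" "(i, j) \<in> E\<^sup>*" "j \<in> {1..n}" for B i j
  proof -
    have "i \<in> {1..n}" using partition_on_block(1)[OF P that(1)] that(2) by blast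
    then have "(i, j) \<in> r" using that by (simp add: r_def)
    then show ?thesis
      using in_quotient_imp_closed[OF \<open>equiv {1..n} r\<close>] that(1,2) unfolding P_def by blast
  qed
  have path: "Poly_Mapping.lookup x i - Poly_Mapping.lookup x j = p i - p j \<and> (\<exists>a::int. p i - p j = of_int a)"
    if "x \<in> F" "(i, j) \<in> E\<^sup>*" for x i j
    using that(2)
  proof (induction rule: rtrancl_induct)
    case base
    show ?case by (auto intro: exI[of _ 0])
  next
    case (step j k)
    from edge[OF that(1) step.hyps(2)] step.IH obtain a b :: int
      where "p i - p j = of_int a" "p j - p k = of_int b" by blast
    then have "p i - p k = of_int (a + b)" by simp
    then show ?case using edge[OF that(1) step.hyps(2)] step.IH by (metis add_diff_eq diff_add_cancel)
  qed
  define h where "h = (\<lambda>B\<in>P. \<lambda>i\<in>B. nat \<lfloor>p i - Min (p ` B)\<rfloor>)"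
  have B: "finite B" "B \<noteq> {}" "B \<subseteq> {1..n}" if "B \<in> P" for B
    using partition_on_interval_block[OF P that] partition_on_block(2)[OF P that] by blast+
  have h: "real (h B i) = p i - Min (p ` B)" if Bi: "B \<in> P" "i \<in> B" for B i
  proof -
    have "Min (p ` B) \<in> p ` B" using B[OF that(1)] by (intro Min_in) auto
    then obtain j where j: "j \<in> B" "Min (p ` B) = p j" by auto
    obtain a :: int where a: "p i - p j = of_int a"
      using path[OF x0 connected[OF Bi j(1)]] by blast
    moreover have "p j \<le> p i" using B[OF that(1)] that(2) by (simp flip: j(2))
    ultimately show ?thesis using that j(2) by (simp add: h_def)
  qed
  have "h B \<in> profiles m B" if "B \<in> P" for B
  proof -
    have "Min (p ` B) \<in> p ` B" using B[OF that] by (intro Min_in) auto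
    then obtain i0 where i0: "i0 \<in> B" "Min (p ` B) = p i0" by auto
    then have "h B i0 = 0" using h[OF that i0(1)] by simp
    have "\<exists>u\<in>B. h B u < h B i \<and> h B i \<le> h B u + m" if i: "i \<in> B" "0 < h B i" for i
    proof -
      have "p i0 < p i" using h[OF \<open>B \<in> P\<close> i(1)] i(2) i0(2) by simp
      then obtain u v where uv: "(i0, u) \<in> E\<^sup>*" "(u, v) \<in> E" "p u < p i" "\<not> p v < p i"
        using rtrancl_crossing[OF connected[OF \<open>B \<in> P\<close> i0(1) i(1)], of "\<lambda>j. p j < p i"] by auto
      then have "u \<in> B" using closed[OF \<open>B \<in> P\<close> i0(1)] by (auto simp: E_def)
      moreover have "p i \<le> p u + real m" using edge[OF x0 uv(2)] uv(4) by linarith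
      ultimately show ?thesis
        using uv(3) h[OF \<open>B \<in> P\<close> i(1)] h[OF \<open>B \<in> P\<close> \<open>u \<in> B\<close>] by (intro bexI[of _ u]) linarith+
    qed
    then show ?thesis
      using i0(1) \<open>h B i0 = 0\<close> \<open>B \<in> P\<close>
      by (auto simp: profiles_def gapped_def h_def image_iff)
  qed
  then have "(P, h) \<in> profiled_partitions m {1..n}"
    using P by (auto simp: profiled_partitions_def h_def)
  moreover have "F = profile_flat n P h"
  proof (intro equalityI subsetI)
    fix x assume "x \<in> F"
    then show "x \<in> profile_flat n P h"
      using \<B>(2) path connected h by (simp add: profile_flat_def)
  next
    fix x assume x: "x \<in> profile_flat n P h"
    show "x \<in> F"
    proof (rule in_F)
      show "x \<in> Rn n" using x by (simp add: profile_flat_def)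
      fix i j assume E: "(i, j) \<in> E"
      then have "i \<in> {1..n}" by (auto simp: E_def)
      then obtain B where "B \<in> P" "i \<in> B" using partition_onD1[OF P] by blast
      moreover have "j \<in> B" using E by (intro closed[OF calculation]) (auto simp: E_def)
      ultimately show "Poly_Mapping.lookup x i - Poly_Mapping.lookup x j = p i - p j"
        using x h by (simp add: profile_flat_def)
    qed
  qed
  ultimately show ?thesis using that by blast
qed

lemma flats_bij:
  "bij_betw (\<lambda>(P, h). profile_flat n P h) (profiled_partitions m {1..n})
     (flats (Rn n) (catalan_arrangement m n))"
  unfolding bij_betw_def
proof (intro conjI profile_flat_inj equalityI subsetI)
  fix F assume "F \<in> flats (Rn n) (catalan_arrangement m n)"
  then obtain P h where "(P, h) \<in> profiled_partitions m {1..n}" "F = profile_flat n P h"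
    by (rule flat_is_profile_flat)
  then show "F \<in> (\<lambda>(P, h). profile_flat n P h) ` profiled_partitions m {1..n}" by force
next
  fix F assume "F \<in> (\<lambda>(P, h). profile_flat n P h) ` profiled_partitions m {1..n}"
  then show "F \<in> flats (Rn n) (catalan_arrangement m n)"
    by (auto simp: profiled_partitions_def intro!: profile_flat_is_flat)
qed

section \<open>Counting flats\<close>

lemma card_flats_of_dim:
  "real (card (flats_of_dim k (Rn n) (catalan_arrangement m n)))
     = fact n * fps_nth (fps_const (1 / fact k) * stack_egf m ^ k) n"
proof -
  let ?\<P> = "{P. partition_on {1..n} P \<and> card P = k}"
  let ?f = "\<lambda>(P, h). profile_flat n P h"
  let ?X = "SIGMA P:?\<P>. \<Pi>\<^sub>E B\<in>P. profiles m B"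
  have "?X \<subseteq> profiled_partitions m {1..n}" by (auto simp: profiled_partitions_def)
  then have "inj_on ?f ?X" using profile_flat_inj inj_on_subset by blast
  have "flats_of_dim k (Rn n) (catalan_arrangement m n)
      = {F \<in> ?f ` profiled_partitions m {1..n}. flat_dim F = k}"
    unfolding flats_of_dim_def bij_betw_imp_surj_on[OF flats_bij] ..
  also have "\<dots> = ?f ` ?X"
    by (auto simp: profiled_partitions_def flat_dim_profile_flat image_iff)
  finally have "card (flats_of_dim k (Rn n) (catalan_arrangement m n)) = card ?X"
    using card_image[OF \<open>inj_on ?f ?X\<close>] by simp
  also have "\<dots> = (\<Sum>P\<in>?\<P>. card (\<Pi>\<^sub>E B\<in>P. profiles m B))"
  proof (rule card_SigmaI[OF finite_partitions])
    show "\<forall>P\<in>?\<P>. finite (\<Pi>\<^sub>E B\<in>P. profiles m B)"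
      using finite_profiles[OF partition_on_interval_block(1)]
      by (auto intro!: finite_PiE finite_elements[of "{1..n}"])
  qed simp
  also have "\<dots> = (\<Sum>P\<in>?\<P>. \<Prod>B\<in>P. card (profiles m B))"
    by (intro sum.cong refl card_PiE) (auto intro: finite_elements[of "{1..n}"])
  finally have "real (card (flats_of_dim k (Rn n) (catalan_arrangement m n)))
     = (\<Sum>P\<in>?\<P>. \<Prod>B\<in>P. real (card (profiles m B)))"
    by simp
  also have "\<dots> = fact (card {1..n}) * fps_nth (fps_const (1 / fact k) * stack_egf m ^ k) (card {1..n})"
    by (rule exponential_formula_partitions)
      (auto simp: card_profiles stack_egf_def fps_divide_unit)
  finally show ?thesis by simp
qed

lemma card_partition_le:
  assumes "finite S" "partition_on S P"
  shows "card P \<le> card S"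
proof -
  have fin: "finite B" if "B \<in> P" for B
    using that assms partition_onD1 finite_subset Union_upper by metis
  have "card P = (\<Sum>B\<in>P. 1)" by simp
  also have "\<dots> \<le> (\<Sum>B\<in>P. card B)"
  proof (rule sum_mono)
    fix B assume "B \<in> P"
    then have "B \<noteq> {}" using partition_onD3[OF assms(2)] by blast
    then show "1 \<le> card B" using fin[OF \<open>B \<in> P\<close>] by (simp add: Suc_le_eq card_gt_0_iff)
  qed
  also have "\<dots> = card (\<Union>P)"
    using card_Union_disjoint[OF partition_onD2[OF assms(2)]] fin by simp
  finally show ?thesis using partition_onD1[OF assms(2)] by simp
qed

lemma card_flats_by_dim:
  "card (flats (Rn n) (catalan_arrangement m n))
     = (\<Sum>k=0..n. card (flats_of_dim k (Rn n) (catalan_arrangement m n)))"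
proof -
  let ?L = "flats (Rn n) (catalan_arrangement m n)"
  have "flat_dim F \<le> n" if F: "F \<in> ?L" for F
  proof -
    obtain P h where "(P, h) \<in> profiled_partitions m {1..n}" "F = profile_flat n P h"
      by (rule flat_is_profile_flat[OF F])
    then show ?thesis
      using card_partition_le[of "{1..n}" P] by (simp add: profiled_partitions_def flat_dim_profile_flat)
  qed
  then have "(\<Sum>k=0..n. \<Sum>F | F \<in> ?L \<and> flat_dim F = k. 1::nat) = (\<Sum>F\<in>?L. 1)"
    by (intro sum.group finite_flats finite_catalan_arrangement) auto
  then show ?thesis by (simp add: flats_of_dim_def)
qed

theorem corollary1p12:
  fixes m k :: nat
  shows "Abs_fps (\<lambda>n. real (card (flats_of_dim k (Rn n) (catalan_arrangement m n))) / fact n)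
           = fps_const (1 / fact k) *
             ((fps_exp 1 - 1) / (1 - of_nat m * (fps_exp 1 - 1))) ^ k
       \<and> Abs_fps (\<lambda>n. real (card (flats (Rn n) (catalan_arrangement m n))) / fact n)
           = fps_exp 1 oo ((fps_exp 1 - 1) / (1 - of_nat m * (fps_exp 1 - 1)))"
  unfolding stack_egf_def[symmetric]
proof (intro conjI fps_ext)
  fix n
  show "fps_nth (Abs_fps (\<lambda>n. real (card (flats_of_dim k (Rn n) (catalan_arrangement m n))) / fact n)) n
      = fps_nth (fps_const (1 / fact k) * stack_egf m ^ k) n"
    by (simp add: card_flats_of_dim)
  show "fps_nth (Abs_fps (\<lambda>n. real (card (flats (Rn n) (catalan_arrangement m n))) / fact n)) n
      = fps_nth (fps_exp 1 oo stack_egf m) n"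
    by (simp add: card_flats_by_dim card_flats_of_dim fps_compose_nth sum_divide_distrib)
qed

end
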